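(* Consider $M$ subsystems controlled by the switched-cost DMPC scheme (Algorithm 1) described in the context, under the standing assumptions listed there, with initial overall state $\Psi_0\in\prod_{i=1}^M\mathcal X_0^i$. Suppose that there are class $\mathcal K$ functions $\alpha_i$ ($i=1,\dots,M$) and a constant $\gamma\in[0,\infty)$ such that for every subsystem $i=1,\dots,M$, every $t\in\mathbb Z^+$ and every $k=0,\dots,N$, $$\text{(a)}\quad J_i(x_{t+1}^i,\hat{\boldsymbol x}_{t+1}^{-i},\boldsymbol u_{t+1}^{i*})-J_i(x_t^i,\hat{\boldsymbol x}_t^{-i},\boldsymbol u_t^{i*})\le-\alpha_i(\|x_t^i\|),$$ $$\text{(b)}\quad \|x_{k,t}^{i}-\hat x_{k,t}^i\|\le\gamma\min_{j\in\mathcal N^i}\|x_{t-1}^i-x_{t-1}^j\|^2,$$ where $x_{k,t}^{i}$ denotes the (optimized) predicted state of subsystem $i$ and $t-1$ means $0^-$ when $t=0$. Then, by applying the control law of Algorithm 1: (i) there exists $T\in\mathbb Z^+$ such that the overall system converges to $\prod_{i=1}^M\bar{\mathcal X}_0^i$ and stays in $\prod_{i=1}^M\bar{\mathcal X}_0^i$ for all $t\ge T$; (ii) $\lim_{t\to\infty}J_i(x_t^i,\hat{\boldsymbol x}_t^{-i},\boldsymbol u_t^{i*})=0$ for all $i=1,\dots,M$.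
   Context: Notation. $\mathbb Z^+$ is the set of nonnegative integers; $\|\cdot\|$ is the Euclidean norm; $\|x\|_P^2=x^TPx$. A class $\mathcal K$ function is a continuous strictly increasing $\alpha:[0,a)\to[0,\infty)$ with $\alpha(0)=0$. Subsystems. There are $M$ subsystems with states $x^i\in\mathbb R^n$ and inputs $u^i\in\mathbb R^m$ obeying the error dynamics $x^i(t+1)=Ax^i(t)+Bu^i(t)$, where $(A,B)$ is controllable and $B$ has full column rank. They are subject to $x^i(t)\in\mathcal X^i\subset\mathbb R^n$, $u^i(t)\in\mathcal U^i\subset\mathbb R^m$. The overall state is $\Psi=[x^{1T},\dots,x^{MT}]^T$. Subsystems interact over a fixed undirected graph on $\{1,\dots,M\}$ in which any two vertices are joined by a path; $\mathcal N^i$ is the set of neighbors $j\ne i$ of $i$. The measured state at time $t$ is $x_t^i$; $x_{k,t}^i$ is the state predicted at time $t$ for time $t+k$, with $x_{0,t}^i=x_t^i$; $u_{k,t}^i$ is the corresponding predicted input. Bold symbols collect a variable over the prediction horizon $N\ge1$: $\boldsymbol x_t^i=(x_{0,t}^i,\dots,x_{N,t}^i)$, $\boldsymbol u_t^i=(u_{0,t}^i,\dots,u_{N-1,t}^i)$. The superscript $*$ denotes optimizers. $\hat{\boldsymbol x}_t^{-i}$ collects the presumed trajectories $\hat{\boldsymbol x}_t^j$, $j\in\mathcal N^i$ (defined below). Standing assumptions. For each $i$, the sets $\mathcal X^i,\bar{\mathcal X}_0^i,\mathcal X_f^i\subseteq\mathcal X^i,\mathcal U^i$ are convex compact polyhedra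 containing the origin as an interior point, and the constraint sets of different subsystems are decoupled. $Q=Q^T\succ0$, $R=R^T\succ0$, $Q_e=q_eI$ with $q_e>0$. There are a linear state feedback $u=Kx$ and $P\succ0$ such that for all $x\in\mathcal X_f$: $u=Kx\in\mathcal U$, $Ax+Bu\in\mathcal X_f$ and $-\|x\|_P^2+\|x\|_Q^2+\|u\|_R^2+\|Ax+Bu\|_P^2\le0$ (for each subsystem). $P_e=P_e^T\succ0$ satisfies $-\|x\|_{P_e}^2+\|x\|_{Q_e}^2+\|(A+BK)x\|_{P_e}^2<0$ for all $x\neq0$. $\mathcal X_0^i$ is the $N$-step backward reachable set of $\mathcal X_f^i$ in $\mathcal X^i$ (states from which some inputs in $\mathcal U^i$ keep the state in $\mathcal X^i$ and bring it into $\mathcal X_f^i$ in $N$ steps). $\bar{\mathcal X}_0^i$ is a control invariant polyhedron with $\mathcal X_f^i\subseteq\bar{\mathcal X}_0^i\subseteq\mathcal X_0^i$. Coupled problem for subsystem $i$ at time $t$: minimize over $\boldsymbol u_t^i$ $$J_i(x_t^i,\hat{\boldsymbol x}_t^{-i},\boldsymbol u_t^i)=\sum_{k=0}^{N-1}\Big(\|x_{k,t}^i\|_Q^2+\|u_{k,t}^i\|_R^2+\sum_{j\in\mathcal N^i}\|x_{k,t}^i-\hat x_{k,t}^j\|_{Q_e}^2\Big)+\|x_{N,t}^i\|_P^2+\sum_{j\in\mathcal N^i}\|x_{N,t}^i-\hat x_{N,t}^j\|_{P_e}^2$$ subject to $x_{k+1,t}^i=Ax_{k,t}^i+Bu_{k,t}^i$,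 $x_{k,t}^i\in\mathcal X^i$, $u_{k,t}^i\in\mathcal U^i$ ($k=0,\dots,N-1$), $x_{N,t}^i\in\mathcal X_f^i$ (the trajectories used for the neighbors being required to satisfy the analogous dynamics and constraints). Decoupled problem for subsystem $i$ at time $t$: minimize over $\boldsymbol u_t^i$ the cost $\sum_{k=0}^{N-1}(\|x_{k,t}^i\|_Q^2+\|u_{k,t}^i\|_R^2)+\|x_{N,t}^i\|_P^2$ subject to $x_{k+1,t}^i=Ax_{k,t}^i+Bu_{k,t}^i$, $x_{k,t}^i\in\bar{\mathcal X}_0^i$, $x_{N,t}^i\in\mathcal X_f^i$, $u_{k,t}^i\in\mathcal U^i$. Algorithm 1. (1) Initialization, at a time $0^-$ immediately preceding $t=0$: every subsystem solves the coupled problem with $q_e=0$ and $P_e=0$ and applies the first input of the optimizer. (2) At each $t\in\mathbb Z^+$, the presumed trajectory of each $j$ is $\hat{\boldsymbol x}_t^j=(x_{1,t-1}^{j*},\dots,x_{N,t-1}^{j*},(A+BK)x_{N,t-1}^{j*})$ ($t-1$ meaning $0^-$ when $t=0$). (3) If $x_t^i\notin\bar{\mathcal X}_0^i$ for some $i\in\{1,\dots,M\}$, every subsystem solves the coupled problem; otherwise every subsystem solves the decoupled problem. The optimizer is $\boldsymbol u_t^{i*}$. (4) Each subsystem applies $u_t^i=u_{0,t}^{i*}$. (5) Repeat from (2) at time $t+1$. *)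

theory Defs
  imports "HOL-Analysis.Analysis"
begin

definition quad :: "real^'n^'n \<Rightarrow> real^'n \<Rightarrow> real" where
  "quad W x = x \<bullet> (W *v x)"

definition pos_def :: "real^'n^'n \<Rightarrow> bool" where
  "pos_def W \<longleftrightarrow> (\<forall>x. x \<noteq> 0 \<longrightarrow> quad W x > 0)"

text \<open>Class K functions on \<open>[0,a)\<close>, where \<open>a\<close> may be infinite.\<close>

definition class_K :: "ereal \<Rightarrow> (real \<Rightarrow> real) \<Rightarrow> bool" where
  "class_K a \<alpha> \<longleftrightarrow> 0 < a \<and>
     continuous_on {r. 0 \<le> r \<and> ereal r < a} \<alpha> \<and>
     strict_mono_on {r. 0 \<le> r \<and> ereal r < a} \<alpha> \<and>
     (\<forall>r. 0 \<le> r \<and> ereal r < a \<longrightarrow> 0 \<le> \<alpha> r) \<and>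
     \<alpha> 0 = 0"

text \<open>\<open>roll A B x u k\<close> is the state reached from \<open>x\<close> after \<open>k\<close> steps under the inputs
  \<open>u 0, \<dots>, u (k - 1)\<close>.\<close>

fun roll :: "real^'n^'n \<Rightarrow> real^'m^'n \<Rightarrow> real^'n \<Rightarrow> (nat \<Rightarrow> real^'m) \<Rightarrow> nat \<Rightarrow> real^'n" where
  "roll A B x u 0 = x"
| "roll A B x u (Suc k) = A *v roll A B x u k + B *v u k"

text \<open>Every state can be steered to every other state in finitely many steps.\<close>

definition controllable :: "real^'n^'n \<Rightarrow> real^'m^'n \<Rightarrow> bool" where
  "controllable A B \<longleftrightarrow> (\<forall>x y. \<exists>k u. roll A B x u k = y)"

text \<open>The problem data. The subsystems are indexed by the finite type \<open>'i\<close>, so that their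
  number \<open>M\<close> is \<open>CARD('i)\<close>. The field \<open>hor\<close> is the horizon \<open>N\<close>, and \<open>wQ\<close>, \<open>wR\<close>, \<open>wP\<close>, \<open>wqe\<close>,
  \<open>wPe\<close> are the weights \<open>Q\<close>, \<open>R\<close>, \<open>P\<close>, \<open>q\<^sub>e\<close>, \<open>P\<^sub>e\<close>. The fields \<open>setX\<close>, \<open>setU\<close>, \<open>setXf\<close>,
  \<open>setXb\<close> are the families of state, input and terminal constraint sets and of the sets
  \<open>\<X>\<close>-bar-0 on which the switching is based.\<close>

record ('n::finite, 'm::finite, 'i::finite) dmpc =
  sysA :: "real^'n^'n"
  sysB :: "real^'m^'n"
  gainK :: "real^'n^'m"
  wQ :: "real^'n^'n"
  wR :: "real^'m^'m"
  wP :: "real^'n^'n"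
  wqe :: real
  wPe :: "real^'n^'n"
  hor :: nat
  edges :: "('i \<times> 'i) set"
  setX :: "'i \<Rightarrow> (real^'n) set"
  setU :: "'i \<Rightarrow> (real^'m) set"
  setXf :: "'i \<Rightarrow> (real^'n) set"
  setXb :: "'i \<Rightarrow> (real^'n) set"

definition nbrs :: "('n::finite, 'm::finite, 'i::finite) dmpc \<Rightarrow> 'i \<Rightarrow> 'i set" where
  "nbrs S i = {j. j \<noteq> i \<and> (i, j) \<in> edges S}"

abbreviation pred_state ::
  "('n::finite, 'm::finite, 'i::finite) dmpc \<Rightarrow> real^'n \<Rightarrow> (nat \<Rightarrow> real^'m) \<Rightarrow> nat \<Rightarrow> real^'n" where
  "pred_state S \<equiv> roll (sysA S) (sysB S)"

text \<open>Input sequences are functions on \<open>nat\<close>; only their values below the horizon matter.\<close>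

definition admissible ::
  "('n::finite, 'm::finite, 'i::finite) dmpc \<Rightarrow> (real^'n) set \<Rightarrow> 'i \<Rightarrow> real^'n
     \<Rightarrow> (nat \<Rightarrow> real^'m) \<Rightarrow> bool" where
  "admissible S X i x u \<longleftrightarrow>
     (\<forall>k<hor S. pred_state S x u k \<in> X \<and> u k \<in> setU S i) \<and>
     pred_state S x u (hor S) \<in> setXf S i"

text \<open>The \<open>N\<close>-step backward reachable set of the terminal set.\<close>

definition setX0 :: "('n::finite, 'm::finite, 'i::finite) dmpc \<Rightarrow> 'i \<Rightarrow> (real^'n) set" where
  "setX0 S i = {x. \<exists>u. admissible S (setX S i) i x u}"

definition control_invariant ::
  "real^'n^'n \<Rightarrow> real^'m^'n \<Rightarrow> (real^'m) set \<Rightarrow> (real^'n) set \<Rightarrow> bool" where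
  "control_invariant A B U C \<longleftrightarrow> (\<forall>x\<in>C. \<exists>u\<in>U. A *v x + B *v u \<in> C)"

definition standing_assumptions :: "('n::finite, 'm::finite, 'i::finite) dmpc \<Rightarrow> bool" where
  "standing_assumptions S \<longleftrightarrow>
     controllable (sysA S) (sysB S) \<and>
     rank (sysB S) = CARD('m) \<and>
     hor S \<ge> 1 \<and>
     sym (edges S) \<and> (\<forall>i j. (i, j) \<in> (edges S)\<^sup>*) \<and>
     (\<forall>i. polyhedron (setX S i) \<and> compact (setX S i) \<and> 0 \<in> interior (setX S i)) \<and>
     (\<forall>i. polyhedron (setU S i) \<and> compact (setU S i) \<and> 0 \<in> interior (setU S i)) \<and>
     (\<forall>i. polyhedron (setXf S i) \<and> compact (setXf S i) \<and> 0 \<in> interior (setXf S i)) \<and>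
     (\<forall>i. polyhedron (setXb S i) \<and> compact (setXb S i) \<and> 0 \<in> interior (setXb S i)) \<and>
     (\<forall>i. setXf S i \<subseteq> setX S i) \<and>
     transpose (wQ S) = wQ S \<and> pos_def (wQ S) \<and>
     transpose (wR S) = wR S \<and> pos_def (wR S) \<and>
     wqe S > 0 \<and>
     pos_def (wP S) \<and>
     (\<forall>i. \<forall>x\<in>setXf S i. let u = gainK S *v x; y = sysA S *v x + sysB S *v u in
        u \<in> setU S i \<and> y \<in> setXf S i \<and>
        - quad (wP S) x + quad (wQ S) x + quad (wR S) u + quad (wP S) y \<le> 0) \<and>
     transpose (wPe S) = wPe S \<and> pos_def (wPe S) \<and>
     (\<forall>x. x \<noteq> 0 \<longrightarrow>
        - quad (wPe S) x + quad (mat (wqe S)) x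
          + quad (wPe S) ((sysA S + sysB S ** gainK S) *v x) < 0) \<and>
     (\<forall>i. control_invariant (sysA S) (sysB S) (setU S i) (setXb S i) \<and>
        setXf S i \<subseteq> setXb S i \<and> setXb S i \<subseteq> setX0 S i)"

text \<open>\<open>cost S i x h u\<close> is \<open>J\<^sub>i\<close>, where \<open>h j k\<close> is the state used for neighbor \<open>j\<close> at step \<open>k\<close>.\<close>

definition cost ::
  "('n::finite, 'm::finite, 'i::finite) dmpc \<Rightarrow> 'i \<Rightarrow> real^'n \<Rightarrow> ('i \<Rightarrow> nat \<Rightarrow> real^'n)
     \<Rightarrow> (nat \<Rightarrow> real^'m) \<Rightarrow> real" where
  "cost S i x h u =
     (\<Sum>k<hor S. quad (wQ S) (pred_state S x u k) + quad (wR S) (u k)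
        + (\<Sum>j\<in>nbrs S i. quad (mat (wqe S)) (pred_state S x u k - h j k)))
     + quad (wP S) (pred_state S x u (hor S))
     + (\<Sum>j\<in>nbrs S i. quad (wPe S) (pred_state S x u (hor S) - h j (hor S)))"

definition coupled_feasible ::
  "('n::finite, 'm::finite, 'i::finite) dmpc \<Rightarrow> 'i \<Rightarrow> real^'n \<Rightarrow> ('i \<Rightarrow> nat \<Rightarrow> real^'n)
     \<Rightarrow> (nat \<Rightarrow> real^'m) \<Rightarrow> bool" where
  "coupled_feasible S i x h u \<longleftrightarrow>
     admissible S (setX S i) i x u \<and>
     (\<forall>j\<in>nbrs S i. \<exists>v. admissible S (setX S j) j (h j 0) v \<and>
        (\<forall>k\<le>hor S. h j k = pred_state S (h j 0) v k))"

definition coupled_optimal ::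
  "('n::finite, 'm::finite, 'i::finite) dmpc \<Rightarrow> 'i \<Rightarrow> real^'n \<Rightarrow> ('i \<Rightarrow> nat \<Rightarrow> real^'n)
     \<Rightarrow> (nat \<Rightarrow> real^'m) \<Rightarrow> bool" where
  "coupled_optimal S i x h u \<longleftrightarrow> is_arg_min (cost S i x h) (coupled_feasible S i x h) u"

definition decoupled_cost ::
  "('n::finite, 'm::finite, 'i::finite) dmpc \<Rightarrow> real^'n \<Rightarrow> (nat \<Rightarrow> real^'m) \<Rightarrow> real" where
  "decoupled_cost S x u =
     (\<Sum>k<hor S. quad (wQ S) (pred_state S x u k) + quad (wR S) (u k))
     + quad (wP S) (pred_state S x u (hor S))"

definition decoupled_optimal ::
  "('n::finite, 'm::finite, 'i::finite) dmpc \<Rightarrow> 'i \<Rightarrow> real^'n \<Rightarrow> (nat \<Rightarrow> real^'m) \<Rightarrow> bool" where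
  "decoupled_optimal S i x u \<longleftrightarrow>
     is_arg_min (decoupled_cost S x) (admissible S (setXb S i) i x) u"

text \<open>Time is \<open>int\<close>-valued, with \<open>-1\<close> standing for the initialization time immediately
  preceding time \<open>0\<close>. \<open>x t i\<close> is the measured state of subsystem \<open>i\<close> at time \<open>t\<close> and \<open>u t i\<close> is
  the input sequence optimized at time \<open>t\<close>. The presumed trajectories are defined for \<open>t \<ge> 0\<close>
  and steps up to the horizon.\<close>

definition presumed ::
  "('n::finite, 'm::finite, 'i::finite) dmpc \<Rightarrow> (int \<Rightarrow> 'i \<Rightarrow> real^'n)
     \<Rightarrow> (int \<Rightarrow> 'i \<Rightarrow> nat \<Rightarrow> real^'m) \<Rightarrow> int \<Rightarrow> 'i \<Rightarrow> nat \<Rightarrow> real^'n" where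
  "presumed S x u t j k =
     (if k < hor S then pred_state S (x (t - 1) j) (u (t - 1) j) (Suc k)
      else (sysA S + sysB S ** gainK S) *v pred_state S (x (t - 1) j) (u (t - 1) j) (hor S))"

text \<open>At time \<open>-1\<close> no presumed trajectories exist yet. The neighbor trajectories entering the
  initialization problem are placeholders: their weights are zero, so that their values do not
  affect the optimizer.\<close>

definition algorithm_run ::
  "('n::finite, 'm::finite, 'i::finite) dmpc \<Rightarrow> (int \<Rightarrow> 'i \<Rightarrow> real^'n)
     \<Rightarrow> (int \<Rightarrow> 'i \<Rightarrow> nat \<Rightarrow> real^'m) \<Rightarrow> bool" where
  "algorithm_run S x u \<longleftrightarrow>
     (\<forall>i. \<exists>h. coupled_optimal (S\<lparr>wqe := 0, wPe := 0\<rparr>) i (x (-1) i) h (u (-1) i)) \<and>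
     (\<forall>t\<ge>0. \<forall>i.
        if \<exists>j. x t j \<notin> setXb S j
        then coupled_optimal S i (x t i) (presumed S x u t) (u t i)
        else decoupled_optimal S i (x t i) (u t i)) \<and>
     (\<forall>t\<ge>-1. \<forall>i. x (t + 1) i = sysA S *v x t i + sysB S *v u t i 0)"

end

(* By (a) the costs decrease along the closed loop and are nonnegative, so the decrements, and
   with them the states, tend to 0; hence the states end up in the neighborhoods setXb of 0 and
   the scheme stays in the decoupled mode.  Near 0 the terminal feedback K is feasible for the
   decoupled problem at cost at most quad P x, so the optimal decoupled cost tends to 0, which
   forces the whole predicted, and therefore the presumed, trajectories to 0.  The cost J is a
   continuous function of these trajectories. *)
theory Submission
  imports Defs
begin

section \<open>Quadratic forms and their limits\<close>

lemma pos_def_quad_nonneg: "pos_def W \<Longrightarrow> 0 \<le> quad W x"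
  by (cases "x = 0") (auto simp: pos_def_def quad_def less_imp_le)

lemma quad_mat_nonneg: "0 \<le> c \<Longrightarrow> 0 \<le> quad (mat c) x"
proof -
  assume "0 \<le> c"
  moreover have "mat c *v x = c *\<^sub>R x"
    by (simp add: vec_eq_iff matrix_vector_mult_def mat_def if_distrib[where f="\<lambda>b. b * _"] cong: if_cong)
  ultimately show ?thesis
    by (simp add: quad_def)
qed

lemma tendsto_quad_zero:
  assumes "(f \<longlongrightarrow> 0) F"
  shows "((\<lambda>t. quad W (f t)) \<longlongrightarrow> 0) F"
proof -
  have "((\<lambda>t. f t \<bullet> (W *v f t)) \<longlongrightarrow> 0 \<bullet> (W *v 0)) F"
    by (intro tendsto_inner assms
        bounded_linear.tendsto[OF matrix_vector_mul_bounded_linear])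
  then show ?thesis by (simp add: quad_def)
qed

lemma quad_scaleR: "quad W (c *\<^sub>R y) = c\<^sup>2 * quad W y"
  by (simp add: quad_def matrix_vector_mult_scaleR power2_eq_square)

text \<open>The constant is the minimum of the form over the compact unit sphere; homogeneity of
  degree 2 carries the bound to all vectors.\<close>

lemma pos_def_coercive:
  assumes "pos_def W"
  obtains c where "c > 0" "\<And>x. c * (norm x)\<^sup>2 \<le> quad W x"
proof -
  have cont: "continuous_on (sphere 0 1) (quad W)"
    unfolding quad_def[abs_def] by (intro continuous_intros)
  have ne: "sphere (0::real^'a) 1 \<noteq> {}"
    using vector_choose_size[of 1] by force
  obtain y where y: "norm y = 1" "\<And>z. norm z = 1 \<Longrightarrow> quad W y \<le> quad W z"
    using continuous_attains_inf[OF compact_sphere ne cont] by auto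
  have "quad W y * (norm x)\<^sup>2 \<le> quad W x" for x
  proof (cases "x = 0")
    case True
    then show ?thesis by (simp add: quad_def)
  next
    case False
    have "quad W y * (norm x)\<^sup>2 \<le> (norm x)\<^sup>2 * quad W ((1 / norm x) *\<^sub>R x)"
      using y(2)[of "(1 / norm x) *\<^sub>R x"] False by (simp add: mult.commute mult_left_mono)
    also have "\<dots> = quad W x"
      using False by (simp add: quad_scaleR power_divide)
    finally show ?thesis .
  qed
  moreover have "quad W y > 0"
  proof -
    have "y \<noteq> 0" using y(1) by auto
    then show ?thesis using assms by (simp add: pos_def_def)
  qed
  ultimately show thesis using that by blast
qed

text \<open>Coercivity bounds the norm of \<open>f t\<close> by the square root of a multiple of the
  form. This turns vanishing costs back into vanishing trajectories.\<close>

lemma tendsto_zero_if_quad: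
  assumes "pos_def W" and lim: "((\<lambda>t. quad W (f t)) \<longlongrightarrow> 0) F"
  shows "(f \<longlongrightarrow> 0) F"
proof -
  obtain c where c: "c > 0" "\<And>x. c * (norm x)\<^sup>2 \<le> quad W x"
    using pos_def_coercive[OF assms(1)] by blast
  have le: "norm (f t) \<le> sqrt (quad W (f t) / c)" for t
    using c by (intro real_le_rsqrt) (simp add: field_simps)
  have "((\<lambda>t. sqrt (quad W (f t) / c)) \<longlongrightarrow> sqrt (0 / c)) F"
    by (intro tendsto_intros lim) (use c in auto)
  then have "((\<lambda>t. sqrt (quad W (f t) / c)) \<longlongrightarrow> 0) F"
    by simp
  then show ?thesis
    by (rule Lim_null_comparison[rotated]) (simp add: le)
qed

section \<open>Limits from class K bounds and from decreasing sequences\<close>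

lemma class_K_tendsto_zero:
  fixes r :: "nat \<Rightarrow> real"
  assumes K: "class_K a \<alpha>" and dom: "\<And>n. 0 \<le> r n" "\<And>n. ereal (r n) < a"
    and lim: "(\<lambda>n. \<alpha> (r n)) \<longlonglongrightarrow> 0"
  shows "r \<longlonglongrightarrow> 0"
proof (rule tendstoI)
  fix e :: real assume e: "e > 0"
  show "\<forall>\<^sub>F n in sequentially. dist (r n) 0 < e"
  proof (cases "ereal e < a")
    case True
    have mono: "strict_mono_on {r. 0 \<le> r \<and> ereal r < a} \<alpha>" and z: "\<alpha> 0 = 0" and a: "0 < a"
      using K by (auto simp: class_K_def)
    \<comment> \<open>Strict monotonicity makes \<open>\<alpha> e\<close> a positive threshold: as
      soon as \<open>\<alpha> (r n)\<close> is below it, \<open>r n\<close> is below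
      \<open>e\<close>.\<close>
    have "\<alpha> 0 < \<alpha> e"
      using a e True by (intro strict_mono_onD[OF mono]) (auto simp: zero_ereal_def)
    then have "\<forall>\<^sub>F n in sequentially. \<alpha> (r n) < \<alpha> e"
      using order_tendstoD(2)[OF lim] z by auto
    then show ?thesis
    proof eventually_elim
      case (elim n)
      have "\<not> e \<le> r n"
        using strict_mono_on_leD[OF mono, of e "r n"] dom[of n] e True elim by auto
      then show ?case using dom(1)[of n] by simp
    qed
  next
    \<comment> \<open>Here \<open>e\<close> is at or beyond the end of the domain of \<alpha>, so
      the domain condition alone gives \<open>r n < e\<close>.\<close>
    case False
    have "r n < e" for n
    proof -
      have "ereal (r n) < ereal e" using False dom(2)[of n] by (meson leI less_le_trans)
      then show ?thesis by simp
    qed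
    then show ?thesis using dom(1) by simp
  qed
qed

text \<open>The filter \<open>at_top\<close> on the integers sees only nonnegative times, where
  \<open>int (nat t)\<close> is \<open>t\<close>. Sequence arguments thus transfer to integer
  time.\<close>

lemma tendsto_int_at_top:
  assumes "(\<lambda>n. f (int n)) \<longlonglongrightarrow> l"
  shows "(f \<longlongrightarrow> l) at_top"
proof -
  have "((\<lambda>t. f (int (nat t))) \<longlongrightarrow> l) at_top"
    using filterlim_compose[OF assms filterlim_nat_sequentially] .
  moreover have "\<forall>\<^sub>F t in at_top. f (int (nat t)) = f t"
    using eventually_ge_at_top[of 0] by eventually_elim simp
  ultimately show ?thesis
    by (rule Lim_transform_eventually)
qed

text \<open>A decreasing sequence bounded below converges, so its successive differences tend to 0,
  and these dominate \<open>g\<close>.\<close>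

lemma decrease_tendsto_zero:
  fixes f g :: "nat \<Rightarrow> real"
  assumes "\<And>n. 0 \<le> f n" "\<And>n. 0 \<le> g n" "\<And>n. f (Suc n) - f n \<le> - g n"
  shows "g \<longlonglongrightarrow> 0"
proof -
  have "decseq f"
  proof (rule decseq_SucI)
    show "f (Suc n) \<le> f n" for n using assms(2,3)[of n] by linarith
  qed
  then obtain L where L: "f \<longlonglongrightarrow> L"
    using decseq_convergent[of f 0] assms(1) by blast
  have "(\<lambda>n. f n - f (Suc n)) \<longlonglongrightarrow> L - L"
    by (intro tendsto_diff L LIMSEQ_Suc)
  then have lim: "(\<lambda>n. f n - f (Suc n)) \<longlonglongrightarrow> 0" by simp
  show ?thesis
  proof (rule tendsto_sandwich[OF _ _ tendsto_const lim])
    show "\<forall>\<^sub>F n in sequentially. 0 \<le> g n" using assms(2) by simp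
    show "\<forall>\<^sub>F n in sequentially. g n \<le> f n - f (Suc n)"
      using assms(3) by (simp add: algebra_simps)
  qed
qed

section \<open>Bounds and limits of the two costs\<close>

lemma cost_nonneg:
  assumes "pos_def (wQ S)" "pos_def (wR S)" "pos_def (wP S)" "pos_def (wPe S)" "0 \<le> wqe S"
  shows "0 \<le> cost S i x h u"
  unfolding cost_def
  using assms by (intro add_nonneg_nonneg sum_nonneg pos_def_quad_nonneg quad_mat_nonneg)

text \<open>The witness \<open>v\<close> iterates the terminal feedback, which keeps the state in
  the terminal set. The terminal inequality says that \<open>quad (wP S)\<close> falls by at least
  the stage cost at each step, so the stage costs telescope.\<close>

lemma feedback_decoupled_cost:
  assumes sa: "standing_assumptions S" and y: "y \<in> setXf S i"
  obtains v where "admissible S (setXb S i) i y v" "decoupled_cost S y v \<le> quad (wP S) y"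
proof -
  let ?K = "\<lambda>z. gainK S *v z"
  define F where "F z = sysA S *v z + sysB S *v ?K z" for z
  define z where "z k = (F ^^ k) y" for k
  define v where "v k = ?K (z k)" for k
  have step: "?K w \<in> setU S i \<and> F w \<in> setXf S i \<and>
      quad (wQ S) w + quad (wR S) (?K w) + quad (wP S) (F w) \<le> quad (wP S) w"
    if "w \<in> setXf S i" for w
  proof -
    have "\<forall>w\<in>setXf S i. let u = gainK S *v w; y = sysA S *v w + sysB S *v u in
        u \<in> setU S i \<and> y \<in> setXf S i \<and>
        - quad (wP S) w + quad (wQ S) w + quad (wR S) u + quad (wP S) y \<le> 0"
      using sa unfolding standing_assumptions_def by metis
    with that show ?thesis by (fastforce simp: Let_def F_def)
  qed
  have z0: "z 0 = y" and zS: "z (Suc k) = F (z k)" for k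
    by (simp_all add: z_def)
  have roll: "pred_state S y v k = z k" for k
    by (induction k) (simp_all add: z0 zS F_def v_def)
  have zf: "z k \<in> setXf S i" for k
    by (induction k) (use y step in \<open>auto simp: z0 zS\<close>)
  have "setXf S i \<subseteq> setXb S i"
    using sa unfolding standing_assumptions_def by metis
  then have adm: "admissible S (setXb S i) i y v"
    unfolding admissible_def roll using zf step by (auto simp: v_def)
  \<comment> \<open>The bound is proved for every length \<open>n\<close> so that induction applies;
    the horizon is one instance.\<close>
  have "(\<Sum>k<n. quad (wQ S) (z k) + quad (wR S) (v k)) + quad (wP S) (z n) \<le> quad (wP S) y" for n
  proof (induction n)
    case 0
    then show ?case by (simp add: z0)
  next
    case (Suc n)
    then show ?case using step[OF zf[of n]] by (simp add: zS v_def)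
  qed
  then have "decoupled_cost S y v \<le> quad (wP S) y"
    unfolding decoupled_cost_def roll by blast
  with adm show thesis by (rule that)
qed

text \<open>The optimum is compared with the feasible feedback sequence. The resulting bound depends
  on the current state alone.\<close>

lemma decoupled_optimal_cost_le:
  assumes "standing_assumptions S" "y \<in> setXf S i" "decoupled_optimal S i y w"
  shows "decoupled_cost S y w \<le> quad (wP S) y"
proof -
  obtain v where v: "admissible S (setXb S i) i y v" "decoupled_cost S y v \<le> quad (wP S) y"
    using feedback_decoupled_cost[OF assms(1,2)] .
  then show ?thesis
    using assms(3) by (force simp: decoupled_optimal_def is_arg_min_def)
qed

text \<open>Every summand of the cost is nonnegative, so the total dominates each one. A small
  optimal cost therefore controls the whole predicted trajectory.\<close>

lemma quad_le_decoupled_cost: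
  assumes "pos_def (wQ S)" "pos_def (wR S)" "pos_def (wP S)"
  shows "k < hor S \<Longrightarrow> quad (wQ S) (pred_state S y w k) \<le> decoupled_cost S y w"
    and "k < hor S \<Longrightarrow> quad (wR S) (w k) \<le> decoupled_cost S y w"
    and "quad (wP S) (pred_state S y w (hor S)) \<le> decoupled_cost S y w"
proof -
  let ?f = "\<lambda>k. quad (wQ S) (pred_state S y w k) + quad (wR S) (w k)"
  note nn = assms[THEN pos_def_quad_nonneg]
  have f: "0 \<le> ?f k" for k
    using nn by (simp add: add_nonneg_nonneg)
  have "?f k \<le> decoupled_cost S y w" if "k < hor S" for k
    using member_le_sum[of k "{..<hor S}" ?f] f that nn(3)[of "pred_state S y w (hor S)"]
    unfolding decoupled_cost_def by simp
  then show "k < hor S \<Longrightarrow> quad (wQ S) (pred_state S y w k) \<le> decoupled_cost S y w"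
    and "k < hor S \<Longrightarrow> quad (wR S) (w k) \<le> decoupled_cost S y w"
    using nn(1)[of "pred_state S y w k"] nn(2)[of "w k"] by force+
  show "quad (wP S) (pred_state S y w (hor S)) \<le> decoupled_cost S y w"
    unfolding decoupled_cost_def using f by (simp add: sum_nonneg)
qed

text \<open>The cost is a finite sum of quadratic forms, each of which vanishes in the limit. Inputs
  enter only through their weighted form, so the limit is asked of that form directly.\<close>

lemma cost_tendsto_zero:
  fixes S :: "('n::finite, 'm::finite, 'i::finite) dmpc"
  assumes "\<And>k. k \<le> hor S \<Longrightarrow> ((\<lambda>t. pred_state S (y t) (w t) k) \<longlongrightarrow> 0) F"
    and "\<And>k. k < hor S \<Longrightarrow> ((\<lambda>t. quad (wR S) (w t k)) \<longlongrightarrow> 0) F"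
    and "\<And>j k. k \<le> hor S \<Longrightarrow> ((\<lambda>t. h t j k) \<longlongrightarrow> 0) F"
  shows "((\<lambda>t. cost S i (y t) (h t) (w t)) \<longlongrightarrow> 0) F"
proof -
  have d: "((\<lambda>t. quad W (pred_state S (y t) (w t) k - h t j k)) \<longlongrightarrow> 0) F"
    if "k \<le> hor S" for W j k
    using tendsto_diff[OF assms(1)[OF that] assms(3)[OF that, of j]] by (simp add: tendsto_quad_zero)
  have q: "((\<lambda>t. quad W (pred_state S (y t) (w t) k)) \<longlongrightarrow> 0) F" if "k \<le> hor S" for W k
    by (rule tendsto_quad_zero[OF assms(1)[OF that]])
  show ?thesis
    unfolding cost_def
    by (intro tendsto_add_zero tendsto_null_sum d q assms(2)) auto
qed


section \<open>Convergence along the closed loop\<close>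

theorem lemma2:
  fixes S :: "('n::finite, 'm::finite, 'i::finite) dmpc"
    and x :: "int \<Rightarrow> 'i \<Rightarrow> real^'n"
    and u :: "int \<Rightarrow> 'i \<Rightarrow> nat \<Rightarrow> real^'m"
    and a :: "'i \<Rightarrow> ereal"
    and \<alpha> :: "'i \<Rightarrow> real \<Rightarrow> real"
    and \<gamma> :: real
  assumes "standing_assumptions S"
    and "algorithm_run S x u"
    and "x 0 \<in> (\<Pi> i\<in>UNIV. setX0 S i)"
    and "\<forall>i. class_K (a i) (\<alpha> i)"
    and "\<gamma> \<ge> 0"
    and "\<forall>i. \<forall>t\<ge>0. ereal (norm (x t i)) < a i"
    and "\<forall>i. \<forall>t\<ge>0.
           cost S i (x (t + 1) i) (presumed S x u (t + 1)) (u (t + 1) i)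
             - cost S i (x t i) (presumed S x u t) (u t i)
           \<le> - \<alpha> i (norm (x t i))"
    and "\<forall>i. \<forall>t\<ge>0. \<forall>k\<le>hor S. nbrs S i \<noteq> {} \<longrightarrow>
           norm (pred_state S (x t i) (u t i) k - presumed S x u t i k)
           \<le> \<gamma> * (MIN j\<in>nbrs S i. (norm (x (t - 1) i - x (t - 1) j))\<^sup>2)"
  shows "(\<exists>T\<ge>0. \<forall>t\<ge>T. x t \<in> (\<Pi> i\<in>UNIV. setXb S i)) \<and>
         (\<forall>i. ((\<lambda>t. cost S i (x t i) (presumed S x u t) (u t i)) \<longlongrightarrow> 0) at_top)"
proof -
  note sa = assms(1)
  have pd: "pos_def (wQ S)" "pos_def (wR S)" "pos_def (wP S)" "pos_def (wPe S)" "0 \<le> wqe S"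
    and int_Xb: "\<And>i. 0 \<in> interior (setXb S i)"
    and int_Xf: "\<And>i. 0 \<in> interior (setXf S i)"
    using sa unfolding standing_assumptions_def by (simp_all add: less_imp_le)
  have state: "((\<lambda>t. x t i) \<longlongrightarrow> 0) at_top" for i
  proof -
    let ?f = "\<lambda>n. cost S i (x (int n) i) (presumed S x u (int n)) (u (int n) i)"
    let ?r = "\<lambda>n. norm (x (int n) i)"
    have K: "class_K (a i) (\<alpha> i)" and dom: "\<And>n. ereal (?r n) < a i"
      using assms(4,6) by auto
    have "(\<lambda>n. \<alpha> i (?r n)) \<longlonglongrightarrow> 0"
    proof (rule decrease_tendsto_zero[of ?f])
      show "0 \<le> ?f n" for n by (rule cost_nonneg[OF pd])
      show "0 \<le> \<alpha> i (?r n)" for n using K dom[of n] by (auto simp: class_K_def)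
      show "?f (Suc n) - ?f n \<le> - \<alpha> i (?r n)" for n
        using assms(7)[rule_format, of "int n" i] by (simp add: add.commute)
    qed
    then have "?r \<longlonglongrightarrow> 0"
      by (rule class_K_tendsto_zero[OF K norm_ge_zero dom])
    then show ?thesis
      by (rule tendsto_int_at_top[OF tendsto_norm_zero_cancel])
  qed
  \<comment> \<open>There are finitely many subsystems, so the times after which each state stays in
    its neighborhood of 0 have a common bound.\<close>
  have near: "\<forall>\<^sub>F t in at_top. \<forall>i. x t i \<in> C i" if "\<And>i. 0 \<in> interior (C i)" for C
  proof (rule eventually_all_finite)
    fix i
    have "\<forall>\<^sub>F t in at_top. x t i \<in> interior (C i)"
      by (rule topological_tendstoD[OF state open_interior that])
    then show "\<forall>\<^sub>F t in at_top. x t i \<in> C i"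
      by eventually_elim (use interior_subset in blast)
  qed
  have in_Xb: "\<forall>\<^sub>F t in at_top. \<forall>i. x t i \<in> setXb S i"
    by (rule near[OF int_Xb])
  have in_Xf: "\<forall>\<^sub>F t in at_top. \<forall>i. x t i \<in> setXf S i"
    by (rule near[OF int_Xf])
  \<comment> \<open>Membership of all states in \<open>setXb\<close> selects the decoupled branch of
    the algorithm; membership in \<open>setXf\<close> makes the feedback bound available.\<close>
  have optimum: "\<forall>\<^sub>F t in at_top. decoupled_cost S (x t i) (u t i) \<le> quad (wP S) (x t i)" for i
    using in_Xb in_Xf eventually_ge_at_top[of 0]
  proof eventually_elim
    case (elim t)
    then have "decoupled_optimal S i (x t i) (u t i)"
      using assms(2) unfolding algorithm_run_def by metis
    then show ?case
      using decoupled_optimal_cost_le[OF sa] elim by blast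
  qed
  \<comment> \<open>Whatever lies between 0 and the optimal decoupled cost is eventually at most
    \<open>quad (wP S)\<close> of the measured state, which tends to 0.\<close>
  have squeeze: "(g \<longlongrightarrow> 0) at_top"
    if "\<And>t. 0 \<le> g t" "\<And>t. g t \<le> decoupled_cost S (x t i) (u t i)" for g i
  proof (rule tendsto_sandwich[OF _ _ tendsto_const tendsto_quad_zero[OF state]])
    show "\<forall>\<^sub>F t in at_top. 0 \<le> g t" using that by simp
    show "\<forall>\<^sub>F t in at_top. g t \<le> quad (wP S) (x t i)"
      using optimum[of i] by eventually_elim (use that order_trans in blast)
  qed
  note le = quad_le_decoupled_cost[OF pd(1-3)]
  have inputs: "((\<lambda>t. quad (wR S) (u t i k)) \<longlongrightarrow> 0) at_top" if "k < hor S" for i k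
    by (rule squeeze[of _ i]) (use pd that le in \<open>auto intro: pos_def_quad_nonneg\<close>)
  have pred: "((\<lambda>t. pred_state S (x t i) (u t i) k) \<longlongrightarrow> 0) at_top" if "k \<le> hor S" for i k
  \<comment> \<open>The last predicted state is weighted by \<open>wP S\<close>, the earlier ones by
    \<open>wQ S\<close>.\<close>
  proof (cases "k = hor S")
    case True
    show ?thesis
      by (rule tendsto_zero_if_quad[OF pd(3)], rule squeeze[of _ i])
        (use pd True le in \<open>auto intro: pos_def_quad_nonneg\<close>)
  next
    case False
    with that have "k < hor S" by simp
    then show ?thesis
      by (intro tendsto_zero_if_quad[OF pd(1)] squeeze[of _ i])
        (use pd le in \<open>auto intro: pos_def_quad_nonneg\<close>)
  qed
  have shift: "filterlim (\<lambda>t::int. t - 1) at_top at_top"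
  proof (subst filterlim_at_top, intro allI)
    show "\<forall>\<^sub>F t in at_top. Z \<le> t - 1" for Z :: int
      using eventually_ge_at_top[of "Z + 1"] by eventually_elim simp
  qed
  have presumed: "((\<lambda>t. presumed S x u t j k) \<longlongrightarrow> 0) at_top" if "k \<le> hor S" for j k
  proof -
    \<comment> \<open>Presumed trajectories come from the predictions made one time unit earlier,
      hence the shifted limit.\<close>
    note prev = filterlim_compose[OF pred shift]
    show ?thesis
    proof (cases "k < hor S")
      case True
      \<comment> \<open>The step index is shifted as well; \<open>k < hor S\<close> keeps
        \<open>Suc k\<close> within the horizon.\<close>
      then show ?thesis using prev[of "Suc k" j] by (simp add: presumed_def)
    next
      case False
      have "((\<lambda>t. (sysA S + sysB S ** gainK S) *v
            pred_state S (x (t - 1) j) (u (t - 1) j) (hor S))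
          \<longlongrightarrow> (sysA S + sysB S ** gainK S) *v 0) at_top"
        by (rule bounded_linear.tendsto[OF matrix_vector_mul_bounded_linear prev]) simp
      with False show ?thesis by (simp add: presumed_def)
    qed
  qed
  have "((\<lambda>t. cost S i (x t i) (presumed S x u t) (u t i)) \<longlongrightarrow> 0) at_top" for i
    by (rule cost_tendsto_zero[OF pred inputs presumed])
  moreover obtain T where "\<And>t i. t \<ge> T \<Longrightarrow> x t i \<in> setXb S i"
    using in_Xb unfolding eventually_at_top_linorder by blast
  then have "\<exists>T\<ge>0. \<forall>t\<ge>T. x t \<in> (\<Pi> i\<in>UNIV. setXb S i)"
    \<comment> \<open>Time is an integer, so the eventual bound \<open>T\<close> may be
      negative.\<close>
    by (intro exI[of _ "max T 0"]) auto
  ultimately show ?thesis by blast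
qed

end
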